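(* Let $\{F_\alpha(z)\}$ be a family of formal power series in $\mathbb C[[z]]$ (indexed by complex weights $\alpha$ including all $\alpha=r+1/2$ with $r\ge0$ an integer) such that $F_\alpha$ is Möbius-covariant of weight $\alpha$. Let $r\ge0$ be an integer, $\alpha:=r+1/2$, $f_m^{(r)}:=[z^m]F_{r+1/2}(z)$, and for $0\le j\le r$ let $$\kappa_{r,j}^F:=\frac{1}{r+1/2}\,[z^r]\,F_{r+1/2}(z)\,A_C(z)\,U_C(z)^j,$$ with $U_C$, $A_C$ the Catalan-type series defined in the context. For an indeterminate $x$ define $$R_{r,F}^{\pm}(x):=\frac1\alpha\,[z^r]\,\frac{F_\alpha(\pm z)}{1-xz},$$ equivalently $$R_{r,F}^+(x)=\frac1\alpha\sum_{m=0}^rf_m^{(r)}x^{r-m},\qquad R_{r,F}^-(x)=\frac1\alpha\sum_{m=0}^r(-1)^mf_m^{(r)}x^{r-m}.$$ Then $$\sum_{j=0}^r\kappa_{r,j}^F\,T_{2j+1}^{\mathrm{Ch}}(\sqrt{x+1})=\sqrt{x+1}\,R_{r,F}^+(x+1)$$ and $$\sum_{j=0}^r\kappa_{r,j}^F\,U_{2j}^{\mathrm{Ch}}(\sqrt{x+1})=R_{r,F}^-(x).$$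
   Context: $[z^r]H(z)$ denotes the coefficient of $z^r$ in the formal power series $H(z)$. For $\beta\in\mathbb C$, $(1-z)^\beta:=\sum_{k\ge0}\binom{\beta}{k}(-z)^k$. A series $F\in\mathbb C[[z]]$ is Möbius-covariant of weight $\alpha$ if $F\!\left(-\frac{z}{1-z}\right)=(1-z)^{-\alpha}F(z)$ in $\mathbb C[[z]]$. Let $C(z):=\frac{1-\sqrt{1-4z}}{2z}\in\mathbb C[[z]]$ be the Catalan generating series, and put $$U_C(z):=C(z/4)-1,\qquad A_C(z):=\frac{2-C(z/4)}{1-z}$$ as formal power series in $z$. $T_n^{\mathrm{Ch}}$ and $U_n^{\mathrm{Ch}}$ are the Chebyshev polynomials of the first and second kinds. *)

theory Defs
  imports Complex_Main "HOL-Computational_Algebra.Computational_Algebra"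
begin

text \<open>
  The formal power \<open>(1 - u)^\<beta> = (\<Sum>k. (\<beta> gchoose k) * (-u)^k)\<close>. The substitution is meaningful
  only for \<open>u\<close> with zero constant term.
\<close>

definition one_minus_powr :: "complex fps \<Rightarrow> complex \<Rightarrow> complex fps" where
  "one_minus_powr u \<beta> = fps_binomial \<beta> oo (- u)"

definition mobius_covariant :: "complex \<Rightarrow> complex fps \<Rightarrow> bool" where
  "mobius_covariant \<alpha> F \<longleftrightarrow>
     F oo (- (fps_X / (1 - fps_X))) = one_minus_powr fps_X (- \<alpha>) * F"

definition catalan_fps :: "complex fps" where
  "catalan_fps = (1 - one_minus_powr (4 * fps_X) (1/2)) / (2 * fps_X)"

definition catalan_quarter :: "complex fps" where
  "catalan_quarter = catalan_fps oo (fps_const (1/4) * fps_X)"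

definition U_C :: "complex fps" where
  "U_C = catalan_quarter - 1"

definition A_C :: "complex fps" where
  "A_C = (2 - catalan_quarter) / (1 - fps_X)"

fun chebyshev_T :: "nat \<Rightarrow> 'a::comm_ring_1 poly" where
  "chebyshev_T 0 = 1"
| "chebyshev_T (Suc 0) = [:0, 1:]"
| "chebyshev_T (Suc (Suc n)) = [:0, 2:] * chebyshev_T (Suc n) - chebyshev_T n"

fun chebyshev_U :: "nat \<Rightarrow> 'a::comm_ring_1 poly" where
  "chebyshev_U 0 = 1"
| "chebyshev_U (Suc 0) = [:0, 2:]"
| "chebyshev_U (Suc (Suc n)) = [:0, 2:] * chebyshev_U (Suc n) - chebyshev_U n"

definition half_weight :: "nat \<Rightarrow> complex" where
  "half_weight r = of_nat r + 1/2"

definition kappa :: "(complex \<Rightarrow> complex fps) \<Rightarrow> nat \<Rightarrow> nat \<Rightarrow> complex" where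
  "kappa F r j = 1 / half_weight r * (F (half_weight r) * A_C * U_C ^ j) $ r"

text \<open>
  \<open>F(z) / (1 - x z)\<close> as a power series in \<open>z\<close> over the polynomial ring in \<open>x\<close>. The inverse is taken
  with \<open>fps_right_inverse\<close> because \<^typ>\<open>complex poly fps\<close> carries no division.
\<close>

definition geometric_quotient :: "complex fps \<Rightarrow> complex poly fps" where
  "geometric_quotient F =
     Abs_fps (\<lambda>n. [:F $ n:]) * fps_right_inverse (1 - fps_const [:0, 1:] * fps_X) 1"

definition R_plus :: "(complex \<Rightarrow> complex fps) \<Rightarrow> nat \<Rightarrow> complex poly" where
  "R_plus F r = smult (1 / half_weight r) (geometric_quotient (F (half_weight r)) $ r)"

definition R_minus :: "(complex \<Rightarrow> complex fps) \<Rightarrow> nat \<Rightarrow> complex poly" where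
  "R_minus F r = smult (1 / half_weight r) (geometric_quotient (F (half_weight r) oo (- fps_X)) $ r)"

text \<open>
  The indeterminate \<open>x\<close> of the theorem is \<^term>\<open>fps_X :: complex fps\<close>, so that \<open>sqrt (x + 1)\<close> is the
  formal power \<open>(1 - (-x))^(1/2)\<close>. Polynomials in \<open>x\<close> are evaluated in the ring of formal power series.
\<close>

definition sqrt_X_plus_1 :: "complex fps" where
  "sqrt_X_plus_1 = one_minus_powr (- fps_X) (1/2)"

definition eval_at_fps :: "complex poly \<Rightarrow> complex fps \<Rightarrow> complex fps" where
  "eval_at_fps p y = poly (map_poly fps_const p) y"

lemma two_X_mult_catalan_fps:
  "2 * fps_X * catalan_fps = 1 - one_minus_powr (4 * fps_X) (1/2)"
proof -
  define S where "S = 1 - one_minus_powr (4 * fps_X) (1/2)"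
  have "S $ 0 = 0"
    by (simp add: S_def one_minus_powr_def)
  hence "S = fps_X * fps_shift 1 S"
    by (intro fps_ext) auto
  moreover have "(2 :: complex fps) * fps_const (1/2) = 1"
    by (simp add: numeral_fps_const)
  ultimately have "S = 2 * fps_X * (fps_const (1/2) * fps_shift 1 S)"
    by (metis mult.assoc mult.commute mult_1)
  hence "2 * fps_X dvd S"
    by (rule dvdI)
  thus ?thesis
    by (simp add: catalan_fps_def S_def)
qed

lemma sqrt_X_plus_1_power2: "sqrt_X_plus_1 ^ 2 = fps_X + 1"
proof -
  have "sqrt_X_plus_1 = fps_binomial (1/2)"
    by (simp add: sqrt_X_plus_1_def one_minus_powr_def)
  hence "sqrt_X_plus_1 ^ 2 = fps_binomial (of_nat 2 * (1/2))"
    using fps_binomial_power by metis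
  also have "of_nat 2 * (1/2) = (1 :: complex)"
    by simp
  finally show ?thesis
    by (simp only: fps_binomial_1 add.commute)
qed

lemma geometric_quotient_nth:
  "geometric_quotient F $ r = (\<Sum>m=0..r. monom (F $ m) (r - m))"
proof -
  define a where "a = 1 - fps_const [:0, 1 :: complex:] * fps_X"
  define g where "g = Abs_fps (\<lambda>n. monom (1 :: complex) n)"
  have "a * g = 1"
  proof (rule fps_ext)
    fix n show "(a * g) $ n = 1 $ n"
      by (cases n) (simp_all add: a_def g_def left_diff_distrib mult.assoc monom_0 monom_Suc one_pCons)
  qed
  hence "g * a = 1"
    by (simp only: mult.commute)
  moreover have "a * fps_right_inverse a 1 = 1"
    by (rule fps_right_inverse) (simp add: a_def)
  ultimately have "fps_right_inverse a 1 = g"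
    using mult.assoc [of g a "fps_right_inverse a 1"] by (simp only: mult_1 mult_1_right)
  thus ?thesis
    by (simp add: geometric_quotient_def a_def [symmetric] fps_mult_nth)
       (simp add: g_def smult_monom)
qed

lemma R_plus_altdef:
  "R_plus F r = smult (1 / half_weight r)
     (\<Sum>m=0..r. monom (F (half_weight r) $ m) (r - m))"
  by (simp add: R_plus_def geometric_quotient_nth)

lemma R_minus_altdef:
  "R_minus F r = smult (1 / half_weight r)
     (\<Sum>m=0..r. monom ((-1) ^ m * F (half_weight r) $ m) (r - m))"
  by (simp add: R_minus_def geometric_quotient_nth fps_compose_uminus')

end

theory Submission
  imports Defs
begin

text \<open>
  With \<open>s = (1 - z)\<^sup>1\<^sup>/\<^sup>2\<close> and \<open>D = C(z/4)\<close> one has \<open>D (1 + s) = 2\<close>, \<open>A_C s = D\<close> and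
  \<open>(1 + U_C)\<^sup>2 - 4 y\<^sup>2 U_C = D\<^sup>2 (1 - y\<^sup>2 z)\<close>. Substituting \<open>u = U_C\<close> in the generating functions
  \<open>\<Sum>\<^sub>j T\<^sub>2\<^sub>j\<^sub>+\<^sub>1(y) u\<^sup>j = y (1 - u) / ((1 + u)\<^sup>2 - 4 y\<^sup>2 u)\<close> and
  \<open>\<Sum>\<^sub>j U\<^sub>2\<^sub>j(y) u\<^sup>j = (1 + u) / ((1 + u)\<^sup>2 - 4 y\<^sup>2 u)\<close> and multiplying by \<open>A_C\<close> therefore gives
  \<open>y / (1 - y\<^sup>2 z)\<close> and \<open>1 / (s (1 - y\<^sup>2 z))\<close>. The first is the claim for \<open>T\<close>. In
  the second, Moebius covariance of weight \<open>r + 1/2\<close> with \<open>w = z / (1 - z)\<close> and \<open>x = y\<^sup>2 - 1\<close> turns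
  \<open>F(z) / (s (1 - y\<^sup>2 z))\<close> into \<open>(1 - z)\<^sup>r\<^sup>-\<^sup>1 F(-w) / (1 - x w)\<close>, and extracting the coefficient of
  \<open>z\<^sup>r\<close> from \<open>(1 - z)\<^sup>r\<^sup>-\<^sup>1 H(w)\<close> yields the coefficient of \<open>w\<^sup>r\<close> in \<open>H\<close>. Both identities hold for all
  complex \<open>y\<close>, hence as polynomials, hence at the formal square root of \<open>x + 1\<close>.
\<close>

section \<open>Evaluation of complex polynomials at a power series\<close>

lemma eval_at_fps_0 [simp]: "eval_at_fps 0 y = 0"
  by (simp add: eval_at_fps_def)

lemma eval_at_fps_pCons [simp]:
  "eval_at_fps (pCons a p) y = fps_const a + y * eval_at_fps p y"
  by (simp add: eval_at_fps_def map_poly_pCons)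

lemma eval_at_fps_1 [simp]: "eval_at_fps 1 y = 1"
  by (simp add: one_pCons)

lemma eval_at_fps_add [simp]: "eval_at_fps (p + q) y = eval_at_fps p y + eval_at_fps q y"
  by (induction p q rule: poly_induct2)
     (simp_all add: algebra_simps fps_const_add [symmetric] del: fps_const_add)

lemma eval_at_fps_smult [simp]: "eval_at_fps (smult c p) y = fps_const c * eval_at_fps p y"
  by (induction p)
     (simp_all add: algebra_simps fps_const_mult [symmetric] del: fps_const_mult)

lemma eval_at_fps_mult [simp]: "eval_at_fps (p * q) y = eval_at_fps p y * eval_at_fps q y"
  by (induction p) (simp_all add: algebra_simps)

lemma eval_at_fps_diff [simp]: "eval_at_fps (p - q) y = eval_at_fps p y - eval_at_fps q y"
  using eval_at_fps_add [of "p - q" q y] by (simp add: algebra_simps)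

lemma eval_at_fps_sum [simp]: "eval_at_fps (sum f S) y = (\<Sum>i\<in>S. eval_at_fps (f i) y)"
  by (induction S rule: infinite_finite_induct) simp_all

lemma eval_at_fps_pcompose:
  "eval_at_fps (pcompose p q) y = eval_at_fps p (eval_at_fps q y)"
  by (induction p) (simp_all add: pcompose_pCons)

text \<open>On the left the Chebyshev polynomial has complex coefficients, on the right it is the
  instance over the ring of power series. They agree because the recurrence involves only
  integers.\<close>

lemma eval_at_fps_chebyshev_T: "eval_at_fps (chebyshev_T n) y = poly (chebyshev_T n) y"
  by (induction n rule: chebyshev_T.induct) (simp_all add: numeral_fps_const)

lemma eval_at_fps_chebyshev_U: "eval_at_fps (chebyshev_U n) y = poly (chebyshev_U n) y"
  by (induction n rule: chebyshev_U.induct) (simp_all add: numeral_fps_const)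

section \<open>Step-two recurrences and Chebyshev generating functions\<close>

lemma chebyshev_T_odd_rec:
  fixes y :: "'a::comm_ring_1"
  shows "poly (chebyshev_T (2 * n + 5)) y
           = (4 * y\<^sup>2 - 2) * poly (chebyshev_T (2 * n + 3)) y - poly (chebyshev_T (2 * n + 1)) y"
proof -
  \<comment> \<open>Written as successors of one base index, all terms unfold to the same two
    consecutive Chebyshev values, and the identity becomes polynomial arithmetic.\<close>
  have *: "2 * n + 5 = Suc (Suc (Suc (Suc (2 * n + 1))))" "2 * n + 3 = Suc (Suc (2 * n + 1))"
    by simp_all
  show ?thesis unfolding * by (simp add: algebra_simps power2_eq_square)
qed

lemma chebyshev_U_even_rec:
  fixes y :: "'a::comm_ring_1"
  shows "poly (chebyshev_U (2 * n + 4)) y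
           = (4 * y\<^sup>2 - 2) * poly (chebyshev_U (2 * n + 2)) y - poly (chebyshev_U (2 * n)) y"
proof -
  have *: "2 * n + 4 = Suc (Suc (Suc (Suc (2 * n))))" "2 * n + 2 = Suc (Suc (2 * n))"
    by simp_all
  show ?thesis unfolding * by (simp add: algebra_simps power2_eq_square)
qed

definition cheb_T_odd_gf :: "complex \<Rightarrow> complex fps" where
  "cheb_T_odd_gf y = Abs_fps (\<lambda>j. poly (chebyshev_T (2 * j + 1)) y)"

definition cheb_U_even_gf :: "complex \<Rightarrow> complex fps" where
  "cheb_U_even_gf y = Abs_fps (\<lambda>j. poly (chebyshev_U (2 * j)) y)"

text \<open>The expanded form displays the coefficients of the step-two recurrences, so multiplying
  a generating function by it kills every coefficient from index 2 on.\<close>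

lemma cheb_gf_denominator:
  "(1 + fps_X)\<^sup>2 - fps_const (4 * y\<^sup>2) * fps_X
     = 1 + fps_const (2 - 4 * y\<^sup>2) * fps_X + fps_X * (fps_X :: 'a::comm_ring_1 fps)"
proof -
  have "fps_const (2 - 4 * y\<^sup>2) = 2 - fps_const (4 * y\<^sup>2)"
    by (simp add: numeral_fps_const)
  thus ?thesis by (simp add: algebra_simps power2_eq_square)
qed

lemma cheb_T_odd_gf_eq:
  "cheb_T_odd_gf y * ((1 + fps_X)\<^sup>2 - fps_const (4 * y\<^sup>2) * fps_X) = fps_const y * (1 - fps_X)"
proof (rule fps_ext)
  fix n
  define G where "G = cheb_T_odd_gf y"
  have *: "G * ((1 + fps_X)\<^sup>2 - fps_const (4 * y\<^sup>2) * fps_X)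
            = G + fps_const (2 - 4 * y\<^sup>2) * (fps_X * G) + fps_X * (fps_X * G)"
    unfolding cheb_gf_denominator by (simp add: algebra_simps)
  \<comment> \<open>The recurrence starts at index 2; the two initial coefficients produce the
    numerator.\<close>
  consider "n = 0" | "n = 1" | m where "n = Suc (Suc m)"
    by (metis One_nat_def not0_implies_Suc)
  thus "(cheb_T_odd_gf y * ((1 + fps_X)\<^sup>2 - fps_const (4 * y\<^sup>2) * fps_X)) $ n
          = (fps_const y * (1 - fps_X)) $ n"
  proof cases
    case 3
    have "G $ n = (4 * y\<^sup>2 - 2) * G $ Suc m - G $ m"
      using chebyshev_T_odd_rec [of m y] 3 by (simp add: G_def cheb_T_odd_gf_def eval_nat_numeral)
    thus ?thesis unfolding G_def [symmetric] * using 3 by (simp add: algebra_simps)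
  qed (unfold G_def [symmetric] *, simp_all add: G_def cheb_T_odd_gf_def algebra_simps eval_nat_numeral)
qed

lemma cheb_U_even_gf_eq:
  "cheb_U_even_gf y * ((1 + fps_X)\<^sup>2 - fps_const (4 * y\<^sup>2) * fps_X) = 1 + fps_X"
proof (rule fps_ext)
  fix n
  define G where "G = cheb_U_even_gf y"
  have *: "G * ((1 + fps_X)\<^sup>2 - fps_const (4 * y\<^sup>2) * fps_X)
            = G + fps_const (2 - 4 * y\<^sup>2) * (fps_X * G) + fps_X * (fps_X * G)"
    unfolding cheb_gf_denominator by (simp add: algebra_simps)
  consider "n = 0" | "n = 1" | m where "n = Suc (Suc m)"
    by (metis One_nat_def not0_implies_Suc)
  thus "(cheb_U_even_gf y * ((1 + fps_X)\<^sup>2 - fps_const (4 * y\<^sup>2) * fps_X)) $ n = (1 + fps_X) $ n"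
  proof cases
    case 3
    have "G $ n = (4 * y\<^sup>2 - 2) * G $ Suc m - G $ m"
      using chebyshev_U_even_rec [of m y] 3 by (simp add: G_def cheb_U_even_gf_def eval_nat_numeral)
    thus ?thesis unfolding G_def [symmetric] * using 3 by (simp add: algebra_simps)
  qed (unfold G_def [symmetric] *, simp_all add: G_def cheb_U_even_gf_def algebra_simps eval_nat_numeral)
qed

section \<open>Coefficients of a composition, and powers of 1 - z\<close>

lemma fps_mult_compose_nth:
  fixes E H u :: "'a::idom fps"
  assumes "u $ 0 = 0"
  shows "(E * (H oo u)) $ r = (\<Sum>j=0..r. H $ j * (E * u ^ j) $ r)"
proof -
  \<comment> \<open>As \<open>u ^ j\<close> starts in degree j, the range may be extended to the
    bound r for every n; the double sum below is then rectangular and can be swapped.\<close>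
  have compose: "(H oo u) $ n = (\<Sum>j=0..r. H $ j * (u ^ j) $ n)" if "n \<le> r" for n
    unfolding fps_compose_nth
    using that assms by (intro sum.mono_neutral_left) (auto simp: startsby_zero_power_prefix)
  have "(E * (H oo u)) $ r = (\<Sum>i=0..r. E $ i * (\<Sum>j=0..r. H $ j * (u ^ j) $ (r - i)))"
    unfolding fps_mult_nth by (intro sum.cong) (simp_all add: compose)
  also have "\<dots> = (\<Sum>i=0..r. \<Sum>j=0..r. H $ j * (E $ i * (u ^ j) $ (r - i)))"
    by (simp add: sum_distrib_left mult_ac)
  also have "\<dots> = (\<Sum>j=0..r. \<Sum>i=0..r. H $ j * (E $ i * (u ^ j) $ (r - i)))"
    by (rule sum.swap)
  also have "\<dots> = (\<Sum>j=0..r. H $ j * (E * u ^ j) $ r)"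
    by (simp add: sum_distrib_left fps_mult_nth)
  finally show ?thesis .
qed

lemma one_minus_powr_X_add:
  "one_minus_powr fps_X (a + b) = one_minus_powr fps_X a * one_minus_powr fps_X b"
  by (simp add: one_minus_powr_def fps_binomial_add_mult fps_compose_mult_distrib)

lemma one_minus_powr_X_0 [simp]: "one_minus_powr fps_X 0 = 1"
  by (simp add: one_minus_powr_def)

lemma one_minus_powr_X_1 [simp]: "one_minus_powr fps_X 1 = 1 - fps_X"
  by (simp add: one_minus_powr_def fps_binomial_1 fps_compose_add_distrib)

lemma one_minus_powr_X_of_nat: "one_minus_powr fps_X (of_nat n) = (1 - fps_X) ^ n"
  by (induction n) (simp_all add: one_minus_powr_X_add)

lemma one_minus_powr_X_nth_0: "one_minus_powr fps_X a $ 0 = 1"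
  by (simp add: one_minus_powr_def)

abbreviation sqrt_1_minus_X :: "complex fps" where
  "sqrt_1_minus_X \<equiv> one_minus_powr fps_X (1/2)"

lemma sqrt_1_minus_X_power2: "sqrt_1_minus_X\<^sup>2 = 1 - fps_X"
  using one_minus_powr_X_add [of "1/2" "1/2"] by (simp add: power2_eq_square)

lemma sqrt_1_minus_X_nonzero: "sqrt_1_minus_X \<noteq> 0"
  using one_minus_powr_X_nth_0 [of "1/2"] by auto

section \<open>Algebraic relations between the Catalan series and the root s of 1 - z\<close>

lemma X_mult_catalan_quarter: "fps_X * catalan_quarter = 2 * (1 - sqrt_1_minus_X)"
proof -
  let ?q = "fps_const (1/4) * fps_X :: complex fps"
  have X4: "(4 * fps_X) oo ?q = fps_X"
    by (simp add: numeral_fps_const fps_compose_mult_distrib mult.assoc [symmetric])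
  have "one_minus_powr (4 * fps_X) (1/2) oo ?q = fps_binomial (1/2) oo ((- (4 * fps_X)) oo ?q)"
    unfolding one_minus_powr_def by (rule fps_compose_assoc [symmetric]) simp_all
  also have "(- (4 * fps_X)) oo ?q = - fps_X"
    by (simp only: fps_compose_uminus X4)
  finally have root: "one_minus_powr (4 * fps_X) (1/2) oo ?q = sqrt_1_minus_X"
    by (simp add: one_minus_powr_def)
  have "(2 * fps_X * catalan_fps) oo ?q = 1 - sqrt_1_minus_X"
    unfolding two_X_mult_catalan_fps by (simp only: fps_compose_sub_distrib fps_compose_1 root)
  moreover have "(2 * fps_X * catalan_fps) oo ?q = fps_const (1/2) * (fps_X * catalan_quarter)"
    by (simp add: numeral_fps_const fps_compose_mult_distrib catalan_quarter_def mult.assoc [symmetric])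
  ultimately have "2 * (fps_const (1/2) * (fps_X * catalan_quarter)) = 2 * (1 - sqrt_1_minus_X)"
    by simp
  thus ?thesis
    by (simp add: numeral_fps_const mult.assoc [symmetric])
qed

text \<open>Multiplied by z, the left side is 2 (1 - s) (1 + s) = 2 z; then z cancels.\<close>

lemma catalan_quarter_mult: "catalan_quarter * (1 + sqrt_1_minus_X) = 2"
proof -
  have "fps_X * (catalan_quarter * (1 + sqrt_1_minus_X))
          = (fps_X * catalan_quarter) * (1 + sqrt_1_minus_X)"
    by (simp only: mult.assoc)
  also have "\<dots> = 2 * (1 - sqrt_1_minus_X\<^sup>2)"
    unfolding X_mult_catalan_quarter by (simp add: algebra_simps power2_eq_square)
  also have "\<dots> = fps_X * 2"
    unfolding sqrt_1_minus_X_power2 by simp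
  finally show ?thesis by simp
qed

lemma catalan_quarter_nonzero: "catalan_quarter \<noteq> 0"
  using catalan_quarter_mult by auto

lemma U_C_nth_0: "U_C $ 0 = 0"
proof -
  have "(catalan_quarter * (1 + sqrt_1_minus_X)) $ 0 = 2"
    unfolding catalan_quarter_mult by simp
  thus ?thesis by (simp add: U_C_def one_minus_powr_X_nth_0)
qed

lemma A_C_mult_sqrt: "A_C * sqrt_1_minus_X = catalan_quarter"
proof -
  let ?s = sqrt_1_minus_X
  have "A_C * (1 - fps_X) = 2 - catalan_quarter"
    unfolding A_C_def by (subst fps_divide_unit) (simp_all add: mult.assoc inverse_mult_eq_1)
  also have "\<dots> = catalan_quarter * ?s"
    using catalan_quarter_mult by (simp add: algebra_simps)
  finally have "(A_C * ?s) * ?s = catalan_quarter * ?s"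
    unfolding sqrt_1_minus_X_power2 [symmetric] by (simp add: power2_eq_square mult_ac)
  thus ?thesis using sqrt_1_minus_X_nonzero by simp
qed

text \<open>Squaring D s = 2 - D gives D^2 z = 4 (D - 1) = 4 \<open>U_C\<close>, while 1 +
  \<open>U_C\<close> = D.\<close>

lemma U_C_denominator:
  "(1 + U_C)\<^sup>2 - fps_const c * U_C * 4 = catalan_quarter\<^sup>2 * (1 - fps_const c * fps_X)"
proof -
  have s: "catalan_quarter * sqrt_1_minus_X = 2 - catalan_quarter"
    using catalan_quarter_mult by (simp add: algebra_simps)
  have "catalan_quarter\<^sup>2 * (1 - fps_X) = (2 - catalan_quarter)\<^sup>2"
    unfolding s [symmetric] sqrt_1_minus_X_power2 [symmetric] by (simp add: power_mult_distrib)
  hence "catalan_quarter\<^sup>2 * fps_X = 4 * U_C"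
    by (simp add: U_C_def power2_eq_square algebra_simps)
  hence "fps_const c * U_C * 4 = catalan_quarter\<^sup>2 * (fps_const c * fps_X)"
    by (simp add: mult_ac)
  thus ?thesis by (simp add: U_C_def algebra_simps)
qed

lemma cheb_denominator_compose_U_C:
  "((1 + fps_X)\<^sup>2 - fps_const (4 * c) * fps_X) oo U_C
     = catalan_quarter\<^sup>2 * (1 - fps_const c * fps_X)"
proof -
  have "fps_const (4 * c) = fps_const c * 4"
    by (simp add: numeral_fps_const mult.commute)
  hence "((1 + fps_X)\<^sup>2 - fps_const (4 * c) * fps_X) oo U_C = (1 + U_C)\<^sup>2 - fps_const c * U_C * 4"
    by (simp add: power2_eq_square fps_compose_sub_distrib fps_compose_add_distrib
        fps_compose_mult_distrib U_C_nth_0 numeral_fps_const mult_ac)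
  thus ?thesis by (simp only: U_C_denominator)
qed

section \<open>The Chebyshev generating functions at \<open>U_C\<close>\<close>

lemma A_C_mult_cheb_T_odd_gf:
  "A_C * (cheb_T_odd_gf y oo U_C) * (1 - fps_const (y\<^sup>2) * fps_X) = fps_const y"
proof -
  let ?D = catalan_quarter and ?s = sqrt_1_minus_X and ?q = "1 - fps_const (y\<^sup>2) * fps_X"
  define G where "G = cheb_T_odd_gf y oo U_C"
  have "G * (?D\<^sup>2 * ?q) = fps_const y * (1 - U_C)"
    using arg_cong [OF cheb_T_odd_gf_eq [of y], of "\<lambda>f. f oo U_C"]
    by (simp only: fps_compose_mult_distrib [OF U_C_nth_0] cheb_denominator_compose_U_C G_def
        fps_const_compose)
       (simp add: fps_compose_sub_distrib U_C_nth_0)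
  also have "1 - U_C = ?D * ?s"
    using catalan_quarter_mult by (simp add: U_C_def algebra_simps)
  \<comment> \<open>Only one factor D is cancelled; the other is rewritten as \<open>A_C\<close>
    times s, which brings in \<open>A_C\<close>.\<close>
  finally have "?D * (G * ?D * ?q) = ?D * (fps_const y * ?s)"
    by (simp add: power2_eq_square mult_ac)
  hence "G * ?D * ?q = fps_const y * ?s"
    using catalan_quarter_nonzero by simp
  hence "?s * (A_C * G * ?q) = ?s * fps_const y"
    unfolding A_C_mult_sqrt [symmetric] by (simp add: mult_ac)
  thus ?thesis using sqrt_1_minus_X_nonzero by (simp add: G_def)
qed

text \<open>Here the numerator 1 + \<open>U_C\<close> is D, without the factor s present in 1 -
  \<open>U_C\<close> = D s. The s that remains is later matched by the half-integer part of the
  weight.\<close>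

lemma A_C_mult_cheb_U_even_gf:
  "sqrt_1_minus_X * (A_C * (cheb_U_even_gf y oo U_C)) * (1 - fps_const (y\<^sup>2) * fps_X) = 1"
proof -
  let ?D = catalan_quarter and ?s = sqrt_1_minus_X and ?q = "1 - fps_const (y\<^sup>2) * fps_X"
  define G where "G = cheb_U_even_gf y oo U_C"
  have "G * (?D\<^sup>2 * ?q) = 1 + U_C"
    using arg_cong [OF cheb_U_even_gf_eq [of y], of "\<lambda>f. f oo U_C"]
    by (simp only: fps_compose_mult_distrib [OF U_C_nth_0] cheb_denominator_compose_U_C G_def)
       (simp add: fps_compose_add_distrib U_C_nth_0)
  hence "?D * (G * ?D * ?q) = ?D * 1"
    by (simp add: power2_eq_square mult_ac U_C_def)
  hence "G * ?D * ?q = 1"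
    using catalan_quarter_nonzero by (metis mult_left_cancel)
  thus ?thesis unfolding A_C_mult_sqrt [symmetric] by (simp add: G_def mult_ac)
qed

section \<open>Both sides as single coefficients\<close>

lemma fps_geometric:
  "Abs_fps (\<lambda>n. x ^ n) * (1 - fps_const x * fps_X) = (1 :: 'a::comm_ring_1 fps)"
proof (rule fps_ext)
  fix n
  have "Abs_fps (\<lambda>n. x ^ n) * (1 - fps_const x * fps_X)
          = Abs_fps (\<lambda>n. x ^ n) - fps_const x * (fps_X * Abs_fps (\<lambda>n. x ^ n))"
    by (simp add: algebra_simps)
  thus "(Abs_fps (\<lambda>n. x ^ n) * (1 - fps_const x * fps_X)) $ n = 1 $ n"
    by (cases n) simp_all
qed

lemma poly_R_plus:
  "poly (R_plus F r) x = 1 / half_weight r * (F (half_weight r) * Abs_fps (\<lambda>n. x ^ n)) $ r"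
  by (simp add: R_plus_altdef poly_sum poly_monom fps_mult_nth)

lemma poly_R_minus:
  "poly (R_minus F r) x
     = 1 / half_weight r * ((F (half_weight r) oo - fps_X) * Abs_fps (\<lambda>n. x ^ n)) $ r"
  by (simp add: R_minus_altdef poly_sum poly_monom fps_mult_nth fps_compose_uminus')

text \<open>Applied with \<open>G\<close> a Chebyshev generating function, this collapses the whole
  sum over j to one coefficient.\<close>

lemma sum_kappa:
  "(\<Sum>j=0..r. kappa F r j * G $ j)
     = 1 / half_weight r * (F (half_weight r) * (A_C * (G oo U_C))) $ r"
  unfolding mult.assoc [symmetric, of "F _"] fps_mult_compose_nth [OF U_C_nth_0]
  by (simp add: kappa_def sum_distrib_left mult_ac)

section \<open>The Moebius substitution\<close>

lemma one_minus_X_power_nth_eq_0: "n < m \<Longrightarrow> (1 - fps_X :: 'a::comm_ring_1 fps) ^ n $ m = 0"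
proof (induction n arbitrary: m)
  case (Suc n)
  thus ?case by (cases m) (simp_all add: left_diff_distrib)
qed simp

text \<open>For j < r, (1 - z)^(r-1) w^j = z^j (1 - z)^(r-1-j) is a polynomial of degree r - 1; for
  j = r it is z^r / (1 - z). So only j = r contributes. The explicit inverse covers r = 0.\<close>

lemma fps_nth_moebius_compose:
  fixes H :: "complex fps"
  shows "((1 - fps_X) ^ r * inverse (1 - fps_X) * (H oo (fps_X / (1 - fps_X)))) $ r = H $ r"
proof -
  let ?d = "1 - fps_X :: complex fps" and ?w = "fps_X / (1 - fps_X) :: complex fps"
  have w: "?w = fps_X * inverse ?d"
    by (rule fps_divide_unit) simp
  have d: "?d * inverse ?d = 1"
    by (rule inverse_mult_eq_1') simp
  have "(?d ^ r * inverse ?d * ?w ^ j) $ r = (if j = r then 1 else 0)" if j: "j \<le> r" for j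
  proof -
    obtain k where r: "r = j + k" using le_Suc_ex [OF j] by blast
    have "?d ^ r * inverse ?d * ?w ^ j
            = (?d * inverse ?d) ^ j * (fps_X ^ j * (?d ^ k * inverse ?d))"
      by (simp add: r w power_add power_mult_distrib mult_ac)
    hence "(?d ^ r * inverse ?d * ?w ^ j) $ r = (?d ^ k * inverse ?d) $ k"
      by (simp only: d power_one mult_1 fps_X_power_mult_nth) (simp add: r)
    also have "\<dots> = (if k = 0 then 1 else 0)"
    proof (cases k)
      case (Suc n)
      have "?d ^ k * inverse ?d = ?d ^ n * (?d * inverse ?d)"
        by (simp only: Suc power_Suc2 mult.assoc)
      thus ?thesis by (simp only: d) (simp add: Suc one_minus_X_power_nth_eq_0)
    qed simp
    finally show ?thesis by (simp add: r)
  qed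
  moreover have "?w $ 0 = 0" by (simp add: w)
  ultimately have "(?d ^ r * inverse ?d * (H oo ?w)) $ r
      = (\<Sum>j=0..r. H $ j * (if j = r then 1 else 0))"
    unfolding fps_mult_compose_nth [OF \<open>?w $ 0 = 0\<close>] by (intro sum.cong) auto
  thus ?thesis by (simp add: if_distrib [of "(*) _"] cong: if_cong)
qed

lemma mobius_covariant_half_weight:
  assumes "mobius_covariant (half_weight r) F"
  shows "F = sqrt_1_minus_X * (1 - fps_X) ^ r * ((F oo - fps_X) oo (fps_X / (1 - fps_X)))"
proof -
  let ?w = "fps_X / (1 - fps_X) :: complex fps"
  have w0: "?w $ 0 = 0"
    by (subst fps_divide_unit) simp_all
  have "(F oo - fps_X) oo ?w = F oo ((- fps_X) oo ?w)"
    by (rule fps_compose_assoc [symmetric]) (simp_all add: w0)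
  also have "(- fps_X) oo ?w = - ?w"
    by (simp add: fps_compose_uminus w0)
  finally have "(F oo - fps_X) oo ?w = one_minus_powr fps_X (- half_weight r) * F"
    using assms by (simp add: mobius_covariant_def)
  \<comment> \<open>The exponents 1/2, r and -(r + 1/2) add up to 0.\<close>
  moreover have "sqrt_1_minus_X * (1 - fps_X) ^ r * one_minus_powr fps_X (- half_weight r) = 1"
    unfolding one_minus_powr_X_of_nat [symmetric] one_minus_powr_X_add [symmetric] half_weight_def
    by simp
  ultimately show ?thesis by (metis mult.assoc mult_1)
qed

text \<open>The factor s in F cancels the one in 1/B, and 1 - (x + 1) z = (1 - z) (1 - x w) turns
  the rest into a series in w times (1 - z)^(r-1).\<close>

lemma mobius_covariant_coefficient:
  fixes F B :: "complex fps"
  assumes "mobius_covariant (half_weight r) F"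
    and B: "sqrt_1_minus_X * B * (1 - fps_const (x + 1) * fps_X) = 1"
  shows "(F * B) $ r = ((F oo - fps_X) * Abs_fps (\<lambda>n. x ^ n)) $ r"
proof -
  let ?d = "1 - fps_X :: complex fps" and ?w = "fps_X / (1 - fps_X) :: complex fps"
    and ?g = "Abs_fps (\<lambda>n. x ^ n)"
  define H where "H = (F oo - fps_X) oo ?w"
  define q where "q = 1 - fps_const (x + 1) * fps_X"
  have w0: "?w $ 0 = 0"
    by (subst fps_divide_unit) simp_all
  have d: "?d * inverse ?d = 1"
    by (rule inverse_mult_eq_1') simp
  have wd: "?w * ?d = fps_X"
    by (subst fps_divide_unit) (simp_all add: mult.assoc inverse_mult_eq_1)
  have "(?g oo ?w) * (1 - fps_const x * ?w) = 1"
    using arg_cong [OF fps_geometric [of x], of "\<lambda>f. f oo ?w"]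
    by (simp add: fps_compose_mult_distrib fps_compose_sub_distrib w0)
  hence "(?g oo ?w) * ((1 - fps_const x * ?w) * ?d) = ?d"
    by (simp only: mult.assoc [symmetric] mult_1)
  moreover have "(1 - fps_const x * ?w) * ?d = q"
  proof -
    have "(1 - fps_const x * ?w) * ?d = ?d - fps_const x * (?w * ?d)"
      by (simp only: left_diff_distrib mult.assoc mult_1)
    also have "\<dots> = q"
      unfolding wd by (simp add: q_def fps_const_add [symmetric] algebra_simps del: fps_const_add)
    finally show ?thesis .
  qed
  ultimately have g: "(?g oo ?w) * q = ?d" by simp
  have "q * (F * B) = ?d ^ r * H * (sqrt_1_minus_X * B * q)"
    by (subst mobius_covariant_half_weight [OF assms(1)]) (simp only: H_def mult_ac)
  \<comment> \<open>The 1 supplied by \<open>B\<close> is split so that its \<open>?d\<close> can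
    become \<open>(?g oo ?w) * q\<close>, after which \<open>q\<close> cancels.\<close>
  also have "\<dots> = ?d ^ r * H * (?d * inverse ?d)"
    using B by (simp only: q_def d)
  also have "\<dots> = q * (?d ^ r * inverse ?d * (H * (?g oo ?w)))"
    by (subst (2) g [symmetric]) (simp only: mult_ac)
  finally have "q * (F * B) = q * (?d ^ r * inverse ?d * (H * (?g oo ?w)))" .
  moreover have "q \<noteq> 0"
    using B by (auto simp: q_def)
  ultimately have "F * B = ?d ^ r * inverse ?d * (H * (?g oo ?w))"
    by simp
  also have "H * (?g oo ?w) = ((F oo - fps_X) * ?g) oo ?w"
    by (simp add: H_def fps_compose_mult_distrib w0)
  finally show ?thesis
    by (simp only: fps_nth_moebius_compose)
qed

section \<open>The identities in y, evaluated at the root of x + 1\<close>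

theorem corollary3p2:
  fixes F :: "complex \<Rightarrow> complex fps"
    and W :: "complex set"
    and r :: nat
  assumes "\<And>k. half_weight k \<in> W"
    and "\<And>\<alpha>. \<alpha> \<in> W \<Longrightarrow> mobius_covariant \<alpha> (F \<alpha>)"
  shows "(\<Sum>j=0..r. fps_const (kappa F r j) * poly (chebyshev_T (2 * j + 1)) sqrt_X_plus_1)
           = sqrt_X_plus_1 * eval_at_fps (R_plus F r) (fps_X + 1) \<and>
         (\<Sum>j=0..r. fps_const (kappa F r j) * poly (chebyshev_U (2 * j)) sqrt_X_plus_1)
           = eval_at_fps (R_minus F r) fps_X"
proof
  let ?y = sqrt_X_plus_1 and ?F = "F (half_weight r)"
  have y2: "?y * ?y = fps_X + 1"
    using sqrt_X_plus_1_power2 by (simp only: power2_eq_square)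
  \<comment> \<open>The variable stands for the root y, and \<open>[:0, 0, 1:]\<close> is y^2, which
    becomes x + 1. Over the infinite field of complex numbers, pointwise equality suffices.\<close>
  have T: "(\<Sum>j=0..r. smult (kappa F r j) (chebyshev_T (2 * j + 1)))
             = [:0, 1:] * pcompose (R_plus F r) [:0, 0, 1:]"
  proof (rule poly_eq_poly_eq_iff [THEN iffD1], rule ext)
    fix y
    let ?B = "A_C * (cheb_T_odd_gf y oo U_C)" and ?g = "Abs_fps (\<lambda>n. (y\<^sup>2) ^ n)"
    have "?B = ?B * (1 - fps_const (y\<^sup>2) * fps_X) * ?g"
      using fps_geometric [of "y\<^sup>2"] by (simp add: mult_ac)
    hence B: "?B = fps_const y * ?g"
      by (simp only: A_C_mult_cheb_T_odd_gf)
    have "(\<Sum>j=0..r. kappa F r j * poly (chebyshev_T (2 * j + 1)) y)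
            = (\<Sum>j=0..r. kappa F r j * cheb_T_odd_gf y $ j)"
      by (simp add: cheb_T_odd_gf_def)
    also have "\<dots> = y * poly (R_plus F r) (y\<^sup>2)"
      unfolding sum_kappa B poly_R_plus by (simp add: mult.left_commute [of ?F])
    finally show "poly (\<Sum>j=0..r. smult (kappa F r j) (chebyshev_T (2 * j + 1))) y
            = poly ([:0, 1:] * pcompose (R_plus F r) [:0, 0, 1:]) y"
      by (simp add: poly_sum poly_pcompose power2_eq_square)
  qed
  show "(\<Sum>j=0..r. fps_const (kappa F r j) * poly (chebyshev_T (2 * j + 1)) ?y)
          = ?y * eval_at_fps (R_plus F r) (fps_X + 1)"
    using arg_cong [OF T, of "\<lambda>p. eval_at_fps p ?y"]
    by (simp add: eval_at_fps_chebyshev_T eval_at_fps_pcompose y2 del: chebyshev_T.simps)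
  \<comment> \<open>\<open>[:-1, 0, 1:]\<close> is y^2 - 1, which evaluates to x at the formal
    root.\<close>
  have U: "(\<Sum>j=0..r. smult (kappa F r j) (chebyshev_U (2 * j)))
             = pcompose (R_minus F r) [:-1, 0, 1:]"
  proof (rule poly_eq_poly_eq_iff [THEN iffD1], rule ext)
    fix y
    let ?B = "A_C * (cheb_U_even_gf y oo U_C)"
    have B: "sqrt_1_minus_X * ?B * (1 - fps_const ((y\<^sup>2 - 1) + 1) * fps_X) = 1"
      using A_C_mult_cheb_U_even_gf [of y] by simp
    have "(\<Sum>j=0..r. kappa F r j * poly (chebyshev_U (2 * j)) y)
            = (\<Sum>j=0..r. kappa F r j * cheb_U_even_gf y $ j)"
      by (simp add: cheb_U_even_gf_def)
    also have "\<dots> = poly (R_minus F r) (y\<^sup>2 - 1)"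
      unfolding sum_kappa poly_R_minus
      by (subst mobius_covariant_coefficient [OF assms(2) [OF assms(1)] B]) (rule refl)
    finally show "poly (\<Sum>j=0..r. smult (kappa F r j) (chebyshev_U (2 * j))) y
            = poly (pcompose (R_minus F r) [:-1, 0, 1:]) y"
      by (simp add: poly_sum poly_pcompose power2_eq_square algebra_simps)
  qed
  show "(\<Sum>j=0..r. fps_const (kappa F r j) * poly (chebyshev_U (2 * j)) ?y)
          = eval_at_fps (R_minus F r) fps_X"
    using arg_cong [OF U, of "\<lambda>p. eval_at_fps p ?y"]
    by (simp add: eval_at_fps_chebyshev_U eval_at_fps_pcompose y2 fps_const_neg [symmetric]
        del: chebyshev_U.simps fps_const_neg)
qed

end
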